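(* Let $d\in\mathbb{N}_0\cup\{\infty\}$ and let $L\in\mathbb{R}[\underline X]_{2d+2}^*$ be a linear form with $L(p^2)\ge 0$ for all $p\in\mathbb{R}[\underline X]_{d+1}$. If $L$ is flat, then the truncated GNS multiplication operators $M_{L,1},\dots,M_{L,n}$ of $L$ commute pairwise.
   Context: $n\in\mathbb{N}$, $\underline X=(X_1,\dots,X_n)$; $\mathbb{R}[\underline X]_k$ is the space of real polynomials of degree at most $k$, $\mathbb{R}[\underline X]_\infty:=\mathbb{R}[\underline X]$ (and $d+1=2d+2=\infty$ if $d=\infty$); $*$ denotes the dual space. For such a linear form $L$: - the truncated GNS kernel is $U_L:=\{p\in\mathbb{R}[\underline X]_{d+1}: L(pq)=0\text{ for all }q\in\mathbb{R}[\underline X]_{d+1}\}$; - the GNS representation space is $V_L:=\mathbb{R}[\underline X]_{d+1}/U_L$, with classes written $\overline p^L$ and inner product $\langle\overline p^L,\overline q^L\rangle_L:=L(pq)$; - the GNS truncation is the subspace $T_L:=\{\overline p^L: p\in\mathbb{R}[\underline X]_d\}\subseteq V_L$, and $\Pi_L$ is the orthogonal projection of $V_L$ onto $T_L$; - the $i$-th truncated GNS multiplication operator is $M_{L,i}:T_L\to T_L$, $\overline p^L\mapsto\Pi_L(\overline{X_ip}^L)$ for $p\in\mathbb{R}[\underline X]_d$; it is a well-defined self-adjoint endomorphism; - $L$ is called flat if $\mathbb{R}[\underline X]_{d+1}=\mathbb{R}[\underline X]_d+U_L$ (equivalently $T_L=V_L$). *)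

theory Defs
  imports Complex_Main "HOL-Library.Extended_Nat" "HOL-Library.Poly_Mapping"
    "HOL-Library.Set_Algebras"
begin

text \<open>
  Real polynomials are finitely supported maps from exponent vectors to coefficients; the
  variables are indexed by a finite type \<open>'n\<close>, whose cardinality is the number of variables.
  Degree bounds and the truncation parameter \<open>d\<close> are extended naturals, so that
  \<open>d + 1 = 2 * d + 2 = \<infinity>\<close> for \<open>d = \<infinity>\<close>.
\<close>

type_synonym 'n rpoly = "('n \<Rightarrow>\<^sub>0 nat) \<Rightarrow>\<^sub>0 real"

definition poly_const :: "real \<Rightarrow> 'n rpoly" where
  "poly_const c = Poly_Mapping.single 0 c"

definition poly_var :: "'n \<Rightarrow> 'n rpoly" where
  "poly_var i = Poly_Mapping.single (Poly_Mapping.single i 1) 1"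

definition mon_degree :: "('n::finite \<Rightarrow>\<^sub>0 nat) \<Rightarrow> nat" where
  "mon_degree m = (\<Sum>i\<in>UNIV. Poly_Mapping.lookup m i)"

definition polys_upto :: "enat \<Rightarrow> 'n::finite rpoly set" where
  "polys_upto k = {p. \<forall>m\<in>Poly_Mapping.keys p. enat (mon_degree m) \<le> k}"

text \<open>
  An element of the dual of \<open>polys_upto k\<close> is represented by a total function, of which only the
  values on \<open>polys_upto k\<close> matter.
\<close>

definition linear_form_upto :: "enat \<Rightarrow> ('n::finite rpoly \<Rightarrow> real) \<Rightarrow> bool" where
  "linear_form_upto k L \<longleftrightarrow>
     (\<forall>p\<in>polys_upto k. \<forall>q\<in>polys_upto k. L (p + q) = L p + L q) \<and>
     (\<forall>c. \<forall>p\<in>polys_upto k. L (poly_const c * p) = c * L p)"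

definition gns_kernel :: "enat \<Rightarrow> ('n::finite rpoly \<Rightarrow> real) \<Rightarrow> 'n rpoly set" where
  "gns_kernel d L = {p \<in> polys_upto (d + 1). \<forall>q\<in>polys_upto (d + 1). L (p * q) = 0}"

definition flat_form :: "enat \<Rightarrow> ('n::finite rpoly \<Rightarrow> real) \<Rightarrow> bool" where
  "flat_form d L \<longleftrightarrow> polys_upto (d + 1) = polys_upto d + gns_kernel d L"

text \<open>
  Elements of the quotient space are cosets of the kernel. Their addition is the elementwise
  addition of sets.
\<close>

definition gns_class :: "enat \<Rightarrow> ('n::finite rpoly \<Rightarrow> real) \<Rightarrow> 'n rpoly \<Rightarrow> 'n rpoly set" where
  "gns_class d L p = p +o gns_kernel d L"

definition gns_space :: "enat \<Rightarrow> ('n::finite rpoly \<Rightarrow> real) \<Rightarrow> 'n rpoly set set" where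
  "gns_space d L = gns_class d L ` polys_upto (d + 1)"

definition gns_inner ::
  "enat \<Rightarrow> ('n::finite rpoly \<Rightarrow> real) \<Rightarrow> 'n rpoly set \<Rightarrow> 'n rpoly set \<Rightarrow> real" where
  "gns_inner d L A B =
     (THE c. \<exists>p\<in>polys_upto (d + 1). \<exists>q\<in>polys_upto (d + 1).
        A = gns_class d L p \<and> B = gns_class d L q \<and> c = L (p * q))"

definition gns_truncation :: "enat \<Rightarrow> ('n::finite rpoly \<Rightarrow> real) \<Rightarrow> 'n rpoly set set" where
  "gns_truncation d L = gns_class d L ` polys_upto d"

text \<open>
  The orthogonal projection sends \<open>A\<close> to the component \<open>B\<close> of the decomposition \<open>A = B + N\<close> with
  \<open>B\<close> in the truncation and \<open>N\<close> orthogonal to the truncation.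
\<close>

definition gns_proj ::
  "enat \<Rightarrow> ('n::finite rpoly \<Rightarrow> real) \<Rightarrow> 'n rpoly set \<Rightarrow> 'n rpoly set" where
  "gns_proj d L A =
     (THE B. B \<in> gns_truncation d L \<and>
        (\<exists>N\<in>gns_space d L. A = B + N \<and> (\<forall>C\<in>gns_truncation d L. gns_inner d L N C = 0)))"

text \<open>
  The operator is only meaningful on the truncation. The representative \<open>p\<close> must have degree at
  most \<open>d\<close>, so that the product with a variable still has degree at most \<open>d + 1\<close>.
\<close>

definition gns_mult_op ::
  "enat \<Rightarrow> ('n::finite rpoly \<Rightarrow> real) \<Rightarrow> 'n \<Rightarrow> 'n rpoly set \<Rightarrow> 'n rpoly set" where
  "gns_mult_op d L i A =
     (THE B. \<exists>p\<in>polys_upto d. A = gns_class d L p \<and>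
        B = gns_proj d L (gns_class d L (poly_var i * p)))"

end

theory Submission
  imports Defs
begin

text \<open>
  Write \<open>U\<close> for the GNS kernel, \<open>[p]\<close> for the class of \<open>p\<close> and \<open>X\<^sub>i\<close> for the variables. Flatness
  makes the truncation the whole representation space, so the projection is the identity and the
  operators are plain multiplication, \<open>M\<^sub>i [p] = [X\<^sub>i p]\<close> for \<open>p\<close> of degree at most \<open>d\<close>
  (\<open>gns_mult_op_class\<close>). This alone does not give commutativity: to apply \<open>M\<^sub>i\<close> to \<open>[X\<^sub>j p]\<close> one must
  first replace \<open>X\<^sub>j p\<close> by a representative \<open>q\<^sub>j\<close> of degree at most \<open>d\<close>, and multiplying the
  kernel element \<open>X\<^sub>j p - q\<^sub>j\<close> by \<open>X\<^sub>i\<close> may exceed degree \<open>d + 1\<close>.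

  The remedy is to test membership in the kernel only against polynomials \<open>r\<close> of degree at
  most \<open>d\<close>, which suffices by flatness (\<open>gns_kernel_testI\<close>). For these \<open>X\<^sub>i r\<close> is still an
  admissible test polynomial, so variables can be moved from one argument to the other:
  \<open>L(X\<^sub>i q\<^sub>j r) = L(q\<^sub>j X\<^sub>i r) = L(X\<^sub>j p X\<^sub>i r)\<close>.
  The last expression is symmetric in \<open>i\<close> and \<open>j\<close>, so \<open>X\<^sub>i q\<^sub>j - X\<^sub>j q\<^sub>i\<close> lies in \<open>U\<close>
  (\<open>gns_kernel_commutator\<close>).
\<close>

section \<open>Degree bounds\<close>

lemma zero_in_polys_upto: "0 \<in> polys_upto k"
  by (simp add: polys_upto_def)

lemma polys_upto_mono: "k \<le> l \<Longrightarrow> polys_upto k \<subseteq> polys_upto l"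
  unfolding polys_upto_def using order_trans by blast

lemma polys_upto_add: "p \<in> polys_upto k \<Longrightarrow> q \<in> polys_upto k \<Longrightarrow> p + q \<in> polys_upto k"
  unfolding polys_upto_def using Poly_Mapping.keys_add[of p q] by blast

lemma polys_upto_diff: "p \<in> polys_upto k \<Longrightarrow> q \<in> polys_upto k \<Longrightarrow> p - q \<in> polys_upto k"
  unfolding polys_upto_def using keys_diff[of p q] by blast

lemma mon_degree_add: "mon_degree (a + b) = mon_degree a + mon_degree b"
  by (simp add: mon_degree_def lookup_add sum.distrib)

lemma polys_upto_mult:
  assumes "p \<in> polys_upto k" "q \<in> polys_upto l"
  shows "p * q \<in> polys_upto (k + l)"
proof -
  have "enat (mon_degree m) \<le> k + l" if m: "m \<in> Poly_Mapping.keys (p * q)" for m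
  proof -
    obtain a b where "m = a + b" "a \<in> Poly_Mapping.keys p" "b \<in> Poly_Mapping.keys q"
      using m keys_mult[of p q] by blast
    then show ?thesis
      using assms add_mono[of "enat (mon_degree a)" k "enat (mon_degree b)" l]
      by (simp add: polys_upto_def mon_degree_add)
  qed
  then show ?thesis
    by (simp add: polys_upto_def)
qed

lemma poly_var_in_polys_upto: "poly_var i \<in> polys_upto 1"
proof -
  have "mon_degree (Poly_Mapping.single i 1) = 1"
    by (simp add: mon_degree_def lookup_single when_def)
  then show ?thesis
    by (simp add: polys_upto_def poly_var_def one_enat_def)
qed

lemma poly_var_mult_in_polys_upto: "p \<in> polys_upto d \<Longrightarrow> poly_var i * p \<in> polys_upto (d + 1)"
  using polys_upto_mult[OF poly_var_in_polys_upto, of p d i] by (simp add: add.commute)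

lemma polys_upto_Suc: "p \<in> polys_upto d \<Longrightarrow> p \<in> polys_upto (d + 1)"
  using polys_upto_mono[of d "d + 1"] by auto

section \<open>The kernel and its cosets\<close>

locale truncated_form =
  fixes d :: enat and L :: "'n::finite rpoly \<Rightarrow> real"
  assumes linear: "linear_form_upto (2 * d + 2) L"
begin

abbreviation U where "U \<equiv> gns_kernel d L"
abbreviation cls where "cls \<equiv> gns_class d L"

lemma mult_in_domain:
  assumes "p \<in> polys_upto (d + 1)" "q \<in> polys_upto (d + 1)"
  shows "p * q \<in> polys_upto (2 * d + 2)"
proof -
  have "(d + 1) + (d + 1) = 2 * d + 2"
    by (metis add.assoc add.commute mult_2 one_add_one)
  then show ?thesis
    using polys_upto_mult[OF assms] by simp
qed

lemma L_add:
  "p \<in> polys_upto (2 * d + 2) \<Longrightarrow> q \<in> polys_upto (2 * d + 2) \<Longrightarrow> L (p + q) = L p + L q"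
  using linear by (simp add: linear_form_upto_def)

lemma L_diff:
  "p \<in> polys_upto (2 * d + 2) \<Longrightarrow> q \<in> polys_upto (2 * d + 2) \<Longrightarrow> L (p - q) = L p - L q"
  using L_add[of "p - q" q] polys_upto_diff by fastforce

lemma L_zero: "L 0 = 0"
  using L_diff[OF zero_in_polys_upto zero_in_polys_upto] by simp

lemma L_mult_diff:
  assumes "p \<in> polys_upto (d + 1)" "q \<in> polys_upto (d + 1)" "r \<in> polys_upto (d + 1)"
  shows "L ((p - q) * r) = L (p * r) - L (q * r)"
  using assms by (simp add: left_diff_distrib L_diff mult_in_domain)

lemma kernel_degree: "u \<in> U \<Longrightarrow> u \<in> polys_upto (d + 1)"
  by (simp add: gns_kernel_def)

lemma kernel_orthogonal: "u \<in> U \<Longrightarrow> q \<in> polys_upto (d + 1) \<Longrightarrow> L (u * q) = 0"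
  by (simp add: gns_kernel_def)

lemma kernel_zero: "0 \<in> U"
  by (simp add: gns_kernel_def zero_in_polys_upto L_zero)

lemma kernel_diff: "u \<in> U \<Longrightarrow> v \<in> U \<Longrightarrow> u - v \<in> U"
  by (simp add: gns_kernel_def polys_upto_diff L_mult_diff)

lemma kernel_uminus: "u \<in> U \<Longrightarrow> - u \<in> U"
  using kernel_diff[OF kernel_zero] by simp

lemma kernel_add: "u \<in> U \<Longrightarrow> v \<in> U \<Longrightarrow> u + v \<in> U"
  using kernel_diff[OF _ kernel_uminus] by fastforce

lemma in_class_iff: "x \<in> cls p \<longleftrightarrow> x - p \<in> U"
  unfolding gns_class_def elt_set_plus_def
  by (auto intro!: bexI[of _ "x - p"])

lemma class_eq_iff: "cls p = cls q \<longleftrightarrow> p - q \<in> U"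
proof
  assume "cls p = cls q"
  moreover have "p \<in> cls p"
    by (simp add: in_class_iff kernel_zero)
  ultimately show "p - q \<in> U"
    by (simp add: in_class_iff)
next
  assume *: "p - q \<in> U"
  have "x - p \<in> U \<longleftrightarrow> x - q \<in> U" for x
    using kernel_add[OF _ *, of "x - p"] kernel_diff[OF _ *, of "x - q"] by auto
  then show "cls p = cls q"
    by (auto simp: in_class_iff)
qed

lemma class_add: "cls p + cls q = cls (p + q)"
proof -
  have "x \<in> cls p + cls q" if "x - (p + q) \<in> U" for x
  proof -
    have "x - q \<in> cls p" "q \<in> cls q"
      using that by (simp_all add: in_class_iff kernel_zero algebra_simps)
    then show ?thesis
      using set_plus_intro by fastforce
  qed
  moreover have "a + b - (p + q) \<in> U" if "a - p \<in> U" "b - q \<in> U" for a b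
    using kernel_add[OF that] by (simp add: algebra_simps)
  ultimately show ?thesis
    by (auto simp: in_class_iff elim!: set_plus_elim)
qed

lemma gns_inner_class:
  assumes "p \<in> polys_upto (d + 1)" "q \<in> polys_upto (d + 1)"
  shows "gns_inner d L (cls p) (cls q) = L (p * q)"
  unfolding gns_inner_def
proof (rule the_equality)
  fix c
  assume "\<exists>p'\<in>polys_upto (d + 1). \<exists>q'\<in>polys_upto (d + 1).
    cls p = cls p' \<and> cls q = cls q' \<and> c = L (p' * q')"
  then obtain p' q' where rep: "p' \<in> polys_upto (d + 1)" "q' \<in> polys_upto (d + 1)"
    and diff: "p - p' \<in> U" "q - q' \<in> U" and c: "c = L (p' * q')"
    by (auto simp: class_eq_iff)
  have "L (p * q) = L (p' * q)"
    using L_mult_diff[OF assms(1) rep(1) assms(2)] kernel_orthogonal[OF diff(1) assms(2)] by simp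
  also have "\<dots> = L (p' * q')"
    using L_mult_diff[OF assms(2) rep(2) rep(1)] kernel_orthogonal[OF diff(2) rep(1)]
    by (simp add: mult.commute)
  finally show "c = L (p * q)"
    using c by simp
qed (use assms in blast)

end

section \<open>Flat forms\<close>

locale flat_truncated_form = truncated_form d L
  for d :: enat and L :: "'n::finite rpoly \<Rightarrow> real" +
  assumes flat: "flat_form d L"
begin

lemma low_degree_representative:
  assumes "p \<in> polys_upto (d + 1)"
  obtains q where "q \<in> polys_upto d" "p - q \<in> U"
proof -
  obtain q u where "p = q + u" "q \<in> polys_upto d" "u \<in> U"
    using assms flat unfolding flat_form_def by (metis set_plus_elim)
  then show thesis
    using that by simp
qed

text \<open>
  A test polynomial of degree \<open>d + 1\<close> differs from one of degree at most \<open>d\<close> by a kernel element,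
  and a kernel element is orthogonal to \<open>p\<close> by symmetry of the form \<open>L(pq)\<close>.
\<close>

lemma gns_kernel_testI:
  assumes p: "p \<in> polys_upto (d + 1)"
    and test: "\<And>r. r \<in> polys_upto d \<Longrightarrow> L (p * r) = 0"
  shows "p \<in> U"
proof -
  have "L (p * q) = 0" if q: "q \<in> polys_upto (d + 1)" for q
  proof -
    obtain r where r: "r \<in> polys_upto d" "q - r \<in> U"
      using low_degree_representative[OF q] .
    have "L (q * p) - L (r * p) = 0"
      using L_mult_diff[OF q polys_upto_Suc[OF r(1)] p] kernel_orthogonal[OF r(2) p] by simp
    then show ?thesis
      using test[OF r(1)] by (simp add: mult.commute)
  qed
  then show ?thesis
    using p by (simp add: gns_kernel_def)
qed

text \<open>
  This is the reason why the operators do not depend on the chosen representative: against test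
  polynomials of degree at most \<open>d\<close> the variable can be moved to the other argument, where
  the kernel property of \<open>p\<close> still applies.
\<close>

lemma gns_kernel_poly_var_mult:
  assumes "p \<in> polys_upto d" "p \<in> U"
  shows "poly_var i * p \<in> U"
proof (rule gns_kernel_testI)
  fix r :: "'n rpoly"
  assume "r \<in> polys_upto d"
  then have "L (p * (poly_var i * r)) = 0"
    using assms(2) kernel_orthogonal poly_var_mult_in_polys_upto by blast
  then show "L (poly_var i * p * r) = 0"
    by (simp add: ac_simps)
qed (use assms poly_var_mult_in_polys_upto in blast)

text \<open>
  Against a test polynomial \<open>r\<close> of degree at most \<open>d\<close>, moving the outer variable to \<open>r\<close> allows
  the representative \<open>qj\<close> to be replaced by \<open>X\<^sub>j p\<close>, and the resulting product
  \<open>X\<^sub>j p X\<^sub>i r\<close> does not see the order of the two variables.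
\<close>

lemma gns_kernel_commutator:
  assumes p: "p \<in> polys_upto d"
    and qi: "qi \<in> polys_upto d" "poly_var i * p - qi \<in> U"
    and qj: "qj \<in> polys_upto d" "poly_var j * p - qj \<in> U"
  shows "poly_var i * qj - poly_var j * qi \<in> U"
proof (rule gns_kernel_testI)
  have move: "L (poly_var k * q * r) = L (poly_var l * p * (poly_var k * r))"
    if q: "q \<in> polys_upto d" "poly_var l * p - q \<in> U" and r: "r \<in> polys_upto d" for k l q r
  proof -
    have "L (poly_var l * p * (poly_var k * r)) - L (q * (poly_var k * r)) = 0"
      using L_mult_diff[OF poly_var_mult_in_polys_upto[OF p] polys_upto_Suc[OF q(1)]
          poly_var_mult_in_polys_upto[OF r]]
        kernel_orthogonal[OF q(2) poly_var_mult_in_polys_upto[OF r]] by simp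
    then show ?thesis
      by (simp add: ac_simps)
  qed
  fix r :: "'n rpoly"
  assume r: "r \<in> polys_upto d"
  have "L (poly_var i * qj * r) = L (poly_var j * qi * r)"
    using move[OF qj r, of i] move[OF qi r, of j] by (simp add: ac_simps)
  then show "L ((poly_var i * qj - poly_var j * qi) * r) = 0"
    using L_mult_diff[OF poly_var_mult_in_polys_upto[OF qj(1)]
        poly_var_mult_in_polys_upto[OF qi(1)] polys_upto_Suc[OF r]] by simp
qed (use qi qj poly_var_mult_in_polys_upto polys_upto_diff in blast)

text \<open>
  By flatness the truncation is the whole space, so a vector orthogonal to it is zero.
\<close>

lemma gns_proj_class:
  assumes p: "p \<in> polys_upto (d + 1)"
  shows "gns_proj d L (cls p) = cls p"
  unfolding gns_proj_def
proof (rule the_equality)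
  obtain q where q: "q \<in> polys_upto d" "p - q \<in> U"
    using low_degree_representative[OF p] .
  have "cls p \<in> gns_truncation d L"
    using q by (auto simp: gns_truncation_def class_eq_iff)
  moreover have "cls 0 \<in> gns_space d L"
    by (simp add: gns_space_def zero_in_polys_upto)
  moreover have "cls p = cls p + cls 0"
    by (simp add: class_add)
  moreover have "gns_inner d L (cls 0) C = 0" if "C \<in> gns_truncation d L" for C
    using that by (auto simp: gns_truncation_def gns_inner_class zero_in_polys_upto
        polys_upto_Suc L_zero)
  ultimately show "cls p \<in> gns_truncation d L \<and> (\<exists>N\<in>gns_space d L. cls p = cls p + N \<and>
      (\<forall>C\<in>gns_truncation d L. gns_inner d L N C = 0))"
    by blast
next
  fix B
  assume "B \<in> gns_truncation d L \<and> (\<exists>N\<in>gns_space d L. cls p = B + N \<and>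
      (\<forall>C\<in>gns_truncation d L. gns_inner d L N C = 0))"
  then obtain b n where B: "B = cls b" and n: "n \<in> polys_upto (d + 1)"
    and sum: "cls p = cls b + cls n"
    and orth: "\<forall>C\<in>gns_truncation d L. gns_inner d L (cls n) C = 0"
    by (auto simp: gns_truncation_def gns_space_def)
  have "L (n * r) = 0" if "r \<in> polys_upto d" for r
    using orth that gns_inner_class[OF n polys_upto_Suc[OF that]]
    by (auto simp: gns_truncation_def)
  then have "n \<in> U"
    using gns_kernel_testI[OF n] by blast
  then have "cls (b + n) = cls b"
    by (simp add: class_eq_iff)
  then show "B = cls p"
    using sum B by (simp add: class_add)
qed

lemma gns_mult_op_class:
  assumes p: "p \<in> polys_upto d"
  shows "gns_mult_op d L i (cls p) = cls (poly_var i * p)"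
  unfolding gns_mult_op_def
proof (rule the_equality)
  show "\<exists>p'\<in>polys_upto d. cls p = cls p' \<and>
      cls (poly_var i * p) = gns_proj d L (cls (poly_var i * p'))"
    using p gns_proj_class poly_var_mult_in_polys_upto by metis
next
  fix B
  assume "\<exists>p'\<in>polys_upto d. cls p = cls p' \<and> B = gns_proj d L (cls (poly_var i * p'))"
  then obtain p' where p': "p' \<in> polys_upto d" "p' - p \<in> U" and B: "B = cls (poly_var i * p')"
    by (metis gns_proj_class poly_var_mult_in_polys_upto class_eq_iff)
  have "poly_var i * (p' - p) \<in> U"
    using gns_kernel_poly_var_mult polys_upto_diff p p' by blast
  then show "B = cls (poly_var i * p)"
    using B by (simp add: class_eq_iff right_diff_distrib)
qed

lemma gns_mult_op_commute:
  assumes "A \<in> gns_truncation d L"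
  shows "gns_mult_op d L i (gns_mult_op d L j A) = gns_mult_op d L j (gns_mult_op d L i A)"
proof -
  obtain p where p: "p \<in> polys_upto d" and A: "A = cls p"
    using assms by (auto simp: gns_truncation_def)
  obtain qi where qi: "qi \<in> polys_upto d" "poly_var i * p - qi \<in> U"
    using low_degree_representative[OF poly_var_mult_in_polys_upto[OF p]] .
  obtain qj where qj: "qj \<in> polys_upto d" "poly_var j * p - qj \<in> U"
    using low_degree_representative[OF poly_var_mult_in_polys_upto[OF p]] .
  have "gns_mult_op d L i A = cls qi" "gns_mult_op d L j A = cls qj"
    using A p qi qj by (simp_all add: gns_mult_op_class class_eq_iff)
  then show ?thesis
    using qi(1) qj(1) gns_kernel_commutator[OF p qi qj]
    by (simp add: gns_mult_op_class class_eq_iff)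
qed

end

theorem proposition5p18:
  fixes d :: enat and L :: "'n::finite rpoly \<Rightarrow> real"
  assumes "linear_form_upto (2 * d + 2) L"
    and "\<forall>p\<in>polys_upto (d + 1). L (p ^ 2) \<ge> 0"
    and "flat_form d L"
  shows "\<forall>i j. \<forall>A\<in>gns_truncation d L.
           gns_mult_op d L i (gns_mult_op d L j A) = gns_mult_op d L j (gns_mult_op d L i A)"
proof -
  interpret flat_truncated_form d L
    using assms by unfold_locales
  show ?thesis
    using gns_mult_op_commute by blast
qed

end
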